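(* Let $k$ be an infinite field, let $n\ge 1$, and let $I\subseteq k[x_1,\dots,x_n]$ be an ideal such that $I\cap k[x_1]=\{0\}$. Then there exists $a\in k$ such that $\mathrm{ev}_a(I)\neq k[x_2,\dots,x_n]$.
   Context: For a field $k$ and $a\in k$, $\mathrm{ev}_a:k[x_1,x_2,\dots,x_n]\to k[x_2,\dots,x_n]$ denotes the evaluation homomorphism $f(x_1,x_2,\dots,x_n)\mapsto f(a,x_2,\dots,x_n)$, and $\mathrm{ev}_a(I)=\{\mathrm{ev}_a(f) : f\in I\}$. When $n=1$, $k[x_2,\dots,x_n]$ means $k$. *)

theory Defs
  imports "HOL-Library.Poly_Mapping" "HOL-Algebra.Ideal" "HOL-Algebra.RingHom"
begin

text \<open>
  A polynomial in variables \<open>x\<^sub>0, x\<^sub>1, \<dots>\<close> with coefficients in \<open>'k\<close> maps finitely many exponent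
  vectors \<open>nat \<Rightarrow>\<^sub>0 nat\<close> to nonzero coefficients; addition and multiplication are those of
  the type \<open>_ \<Rightarrow>\<^sub>0 _\<close> (multiplication being convolution).
\<close>

type_synonym 'k mpoly = "(nat \<Rightarrow>\<^sub>0 nat) \<Rightarrow>\<^sub>0 'k"

definition mpolys :: "nat set \<Rightarrow> 'k::zero mpoly set" where
  "mpolys V = {f. \<forall>m \<in> Poly_Mapping.keys f. Poly_Mapping.keys m \<subseteq> V}"

definition mpoly_ring :: "nat set \<Rightarrow> 'k::comm_ring_1 mpoly ring" where
  "mpoly_ring V = \<lparr>carrier = mpolys V, monoid.mult = (*), one = 1, ring.zero = 0, add = (+)\<rparr>"

text \<open>
  Substitution of \<open>a\<close> for \<open>x\<^sub>1\<close>: the term \<open>c x\<^sub>1\<^sup>e x\<^sub>2\<^sup>f \<dots>\<close> becomes \<open>(c a\<^sup>e) x\<^sub>2\<^sup>f \<dots>\<close>.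
\<close>

definition ev :: "'k::comm_ring_1 \<Rightarrow> 'k mpoly \<Rightarrow> 'k mpoly" where
  "ev a f = (\<Sum>m \<in> Poly_Mapping.keys f.
     Poly_Mapping.single (Poly_Mapping.update 1 0 m)
       (Poly_Mapping.lookup f m * a ^ Poly_Mapping.lookup m 1))"

lemma mpolys_zero: "0 \<in> mpolys V"
  by (simp add: mpolys_def)

lemma mpolys_one: "(1 :: 'k::comm_ring_1 mpoly) \<in> mpolys V"
  by (simp add: mpolys_def)

lemma mpolys_uminus: "f \<in> mpolys V \<Longrightarrow> - f \<in> mpolys V"
  for f :: "'k::comm_ring_1 mpoly"
  by (simp add: mpolys_def Poly_Mapping.in_keys_iff)

lemma mpolys_add: "f \<in> mpolys V \<Longrightarrow> g \<in> mpolys V \<Longrightarrow> f + g \<in> mpolys V"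
  for f g :: "'k::comm_ring_1 mpoly"
  using Poly_Mapping.keys_add[of f g] by (fastforce simp: mpolys_def)

lemma mpolys_mult:
  fixes f g :: "'k::comm_ring_1 mpoly"
  assumes "f \<in> mpolys V" "g \<in> mpolys V"
  shows "f * g \<in> mpolys V"
  unfolding mpolys_def
proof safe
  fix m i
  assume "m \<in> Poly_Mapping.keys (f * g)" and i: "i \<in> Poly_Mapping.keys m"
  then obtain u v where uv: "m = u + v" "u \<in> Poly_Mapping.keys f" "v \<in> Poly_Mapping.keys g"
    using Poly_Mapping.keys_mult[of f g] by blast
  then have "i \<in> Poly_Mapping.keys u \<union> Poly_Mapping.keys v"
    using i Poly_Mapping.keys_add[of u v] by blast
  then show "i \<in> V"
    using assms uv by (auto simp: mpolys_def)
qed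

lemma mpolys_sum: "(\<And>x. x \<in> A \<Longrightarrow> F x \<in> mpolys V) \<Longrightarrow> sum F A \<in> mpolys V"
  for F :: "'a \<Rightarrow> 'k::comm_ring_1 mpoly"
  by (induction A rule: infinite_finite_induct) (auto simp: mpolys_zero mpolys_add)

lemma cring_mpoly_ring: "cring (mpoly_ring V :: 'k::comm_ring_1 mpoly ring)"
proof (rule cringI)
  show "abelian_group (mpoly_ring V :: 'k mpoly ring)"
  proof (rule abelian_groupI)
    fix f :: "'k mpoly"
    assume "f \<in> carrier (mpoly_ring V)"
    then show "\<exists>g \<in> carrier (mpoly_ring V). g \<oplus>\<^bsub>mpoly_ring V\<^esub> f = \<zero>\<^bsub>mpoly_ring V\<^esub>"
      by (intro bexI[of _ "- f"]) (auto simp: mpoly_ring_def mpolys_uminus)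
  qed (auto simp: mpoly_ring_def mpolys_zero mpolys_add algebra_simps)
  show "Group.comm_monoid (mpoly_ring V :: 'k mpoly ring)"
    by (rule comm_monoidI) (auto simp: mpoly_ring_def mpolys_one mpolys_mult algebra_simps)
qed (auto simp: mpoly_ring_def algebra_simps)

lemma ev_superset:
  assumes "finite A" "Poly_Mapping.keys f \<subseteq> A"
  shows "ev a f = (\<Sum>m \<in> A. Poly_Mapping.single (Poly_Mapping.update 1 0 m)
           (Poly_Mapping.lookup f m * a ^ Poly_Mapping.lookup m 1))"
  unfolding ev_def
  by (rule sum.mono_neutral_left) (use assms in \<open>auto simp: Poly_Mapping.in_keys_iff\<close>)

lemma ev_single:
  "ev a (Poly_Mapping.single m c) =
     Poly_Mapping.single (Poly_Mapping.update 1 0 m) (c * a ^ Poly_Mapping.lookup m 1)"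
  by (subst ev_superset[of "{m}"]) auto

lemma ev_add: "ev a (f + g) = ev a f + ev a g"
proof -
  let ?A = "Poly_Mapping.keys f \<union> Poly_Mapping.keys g"
  show ?thesis
    using Poly_Mapping.keys_add[of f g]
    by (simp add: ev_superset[of ?A] lookup_add distrib_right Poly_Mapping.single_add sum.distrib)
qed

lemma ev_zero [simp]: "ev a 0 = 0"
  by (simp add: ev_def)

lemma ev_sum: "ev a (sum F A) = (\<Sum>x \<in> A. ev a (F x))"
  by (induction A rule: infinite_finite_induct) (auto simp: ev_add)

lemma update_exponent_add:
  "Poly_Mapping.update i 0 (u + v) = Poly_Mapping.update i 0 u + Poly_Mapping.update i 0 v"
  for u v :: "nat \<Rightarrow>\<^sub>0 nat"
  by (rule poly_mapping_eqI) (simp add: lookup_update lookup_add)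

lemma mpoly_eq_sum_single:
  "f = (\<Sum>m \<in> Poly_Mapping.keys f. Poly_Mapping.single m (Poly_Mapping.lookup f m))"
  by (rule poly_mapping_eqI)
    (auto simp: lookup_sum lookup_single when_def sum.delta' Poly_Mapping.in_keys_iff)

lemma ev_mult: "ev a (f * g) = ev a f * ev a g"
proof -
  let ?t = "\<lambda>f m. Poly_Mapping.single m (Poly_Mapping.lookup f m)"
  have "ev a (f * g) = ev a (sum (?t f) (Poly_Mapping.keys f) * sum (?t g) (Poly_Mapping.keys g))"
    by (simp flip: mpoly_eq_sum_single)
  also have "\<dots> = (\<Sum>u \<in> Poly_Mapping.keys f. \<Sum>v \<in> Poly_Mapping.keys g. ev a (?t f u) * ev a (?t g v))"
    by (simp add: sum_product ev_sum mult_single ev_single update_exponent_add lookup_add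
        power_add mult_ac)
  also have "\<dots> = ev a (sum (?t f) (Poly_Mapping.keys f)) * ev a (sum (?t g) (Poly_Mapping.keys g))"
    by (simp add: sum_product ev_sum)
  finally show ?thesis
    by (simp flip: mpoly_eq_sum_single)
qed

lemma update_zero: "Poly_Mapping.update i 0 (0 :: nat \<Rightarrow>\<^sub>0 nat) = 0"
  by (rule poly_mapping_eqI) (simp add: lookup_update)

lemma ev_const: "ev a (Poly_Mapping.single 0 c) = Poly_Mapping.single 0 c"
  by (simp add: ev_single update_zero)

lemma ev_var:
  "ev a (Poly_Mapping.single (Poly_Mapping.single i 1) 1) =
     (if i = 1 then Poly_Mapping.single 0 a else Poly_Mapping.single (Poly_Mapping.single i 1) 1)"
proof -
  have "Poly_Mapping.update 1 0 (Poly_Mapping.single i (1::nat)) =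
          (if i = 1 then 0 else Poly_Mapping.single i 1)"
    by (rule poly_mapping_eqI) (auto simp: lookup_update lookup_single when_def)
  then show ?thesis
    by (auto simp: ev_single lookup_single when_def)
qed

lemma ev_ring_hom: "ev (a :: 'k::comm_ring_1) \<in> ring_hom (mpoly_ring {1..n}) (mpoly_ring {2..n})"
proof (rule ring_hom_memI)
  fix f :: "'k mpoly" assume "f \<in> carrier (mpoly_ring {1..n})"
  then have f: "f \<in> mpolys {1..n}" by (simp add: mpoly_ring_def)
  show "ev a f \<in> carrier (mpoly_ring {2..n})"
    unfolding ev_def mpoly_ring_def partial_object.simps
  proof (rule mpolys_sum)
    fix m assume "m \<in> Poly_Mapping.keys f"
    then have "Poly_Mapping.keys m \<subseteq> {1..n}" using f by (auto simp: mpolys_def)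
    then have "Poly_Mapping.keys (Poly_Mapping.update 1 0 m) \<subseteq> {2..n}"
      by (force simp: keys_update)
    then show "Poly_Mapping.single (Poly_Mapping.update 1 0 m)
        (Poly_Mapping.lookup f m * a ^ Poly_Mapping.lookup m 1) \<in> mpolys {2..n}"
      by (auto simp: mpolys_def)
  qed
qed (auto simp: mpoly_ring_def ev_mult ev_add ev_const simp flip: Poly_Mapping.single_one)

end

theory Submission
  imports Defs "HOL-Computational_Algebra.Polynomial"
begin

text \<open>
  The quotient \<open>k[x\<^sub>1, \<dots>, x\<^sub>n] / I\<close> becomes free over \<open>k[x\<^sub>1]\<close> after inverting one nonzero
  \<open>h \<in> k[x\<^sub>1]\<close>. To see this, order the monomials in \<open>x\<^sub>2, \<dots>, x\<^sub>n\<close> lexicographically and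
  consider leading terms with coefficients in \<open>k[x\<^sub>1]\<close>. By Dickson's lemma finitely many leading
  terms of elements of \<open>I\<close> generate all leading monomials; let \<open>h\<close> be the product of their
  coefficients. Division with remainder then gives, for every \<open>g\<close>, some \<open>N\<close> and a standard \<open>r\<close>
  (no monomial of \<open>r\<close> is a leading monomial of \<open>I\<close>) with \<open>h\<^sup>N g - r \<in> I\<close>, and \<open>0\<close> is the only
  standard element of \<open>I\<close>. As \<open>k\<close> is infinite, \<open>h(a) \<noteq> 0\<close> for some \<open>a\<close>. If \<open>f \<in> I\<close> had
  \<open>ev\<^sub>a f = 1\<close>, then \<open>f = 1 + (x\<^sub>1 - a) g\<close>, so \<open>h\<^sup>N + (x\<^sub>1 - a) r\<close> would be a standard element
  of \<open>I\<close>; hence it would vanish, and so would \<open>h(a)\<close>.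
\<close>

declare One_nat_def [simp del]

subsection \<open>Dickson's lemma and the lexicographic order\<close>

text \<open>A monotone subsequence exists. If it decreases, it is constant from the index of its
  least value on, and that tail is increasing.\<close>

lemma incseq_subseq_nat:
  fixes s :: "nat \<Rightarrow> nat"
  shows "\<exists>r. strict_mono r \<and> incseq (s \<circ> r)"
proof -
  obtain r where r: "strict_mono r" and mono: "monoseq (\<lambda>i. s (r i))"
    using seq_monosub by blast
  show ?thesis
  proof (cases "incseq (\<lambda>i. s (r i))")
    case True
    with r show ?thesis by (auto simp: comp_def)
  next
    case False
    with mono have dec: "decseq (\<lambda>i. s (r i))"
      by (auto simp: monoseq_iff)
    obtain N where N: "\<And>i. s (r N) \<le> s (r i)"
      using ex_has_least_nat[of "\<lambda>_. True" 0 "\<lambda>i. s (r i)"] by auto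
    have "s (r (N + i)) = s (r N)" for i
      using dec N[of "N + i"] by (intro antisym) (auto simp: decseq_def)
    moreover have "strict_mono (\<lambda>i. r (N + i))"
      using r by (auto simp: strict_mono_def)
    ultimately show ?thesis
      by (intro exI[of _ "\<lambda>i. r (N + i)"]) (auto simp: incseq_def)
  qed
qed

text \<open>Thinning preserves monotonicity of the components already treated, so they can be
  handled one after another.\<close>

lemma incseq_subseq_componentwise:
  fixes s :: "nat \<Rightarrow> 'a \<Rightarrow> nat"
  assumes "finite V"
  shows "\<exists>r. strict_mono r \<and> (\<forall>i \<in> V. incseq (\<lambda>j. s (r j) i))"
  using assms
proof induction
  case empty
  show ?case by (auto intro: strict_mono_id)
next
  case (insert v V)
  then obtain r where r: "strict_mono r" "\<forall>i \<in> V. incseq (\<lambda>j. s (r j) i)" by blast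
  obtain q where q: "strict_mono q" "incseq ((\<lambda>j. s (r j) v) \<circ> q)"
    using incseq_subseq_nat by blast
  have "strict_mono (r \<circ> q)"
    using r(1) q(1) by (auto simp: strict_mono_def)
  moreover have "incseq (\<lambda>j. s (r (q j)) i)" if "i \<in> V" for i
    using r(2) that strict_mono_leD[OF q(1)] unfolding incseq_def by blast
  ultimately show ?case
    using q(2) by (intro exI[of _ "r \<circ> q"]) (auto simp: comp_def)
qed

lemma poly_mapping_add_diff:
  fixes s t :: "'a \<Rightarrow>\<^sub>0 nat"
  assumes "\<And>i. Poly_Mapping.lookup s i \<le> Poly_Mapping.lookup t i"
  shows "t = s + (t - s)"
  by (rule poly_mapping_eqI) (simp add: lookup_add lookup_minus assms)

text \<open>The order compares at the least index where two vectors differ, so \<open>m < 0\<close>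
  would require an entry below \<open>0\<close>.\<close>

lemma zero_le_poly_mapping: "0 \<le> (m :: nat \<Rightarrow>\<^sub>0 nat)"
proof (rule leI, rule notI)
  assume "m < 0"
  then show False by transfer (auto simp: less_fun_def)
qed

text \<open>Once every component in \<open>V\<close> increases along a subsequence, its first term
  divides its second.\<close>

lemma poly_mapping_good_sequence:
  fixes s :: "nat \<Rightarrow> 'a \<Rightarrow>\<^sub>0 nat"
  assumes "finite V" "\<And>j. Poly_Mapping.keys (s j) \<subseteq> V"
  obtains i j d where "i < j" "s j = s i + d"
proof -
  obtain r where r: "strict_mono r" "\<forall>v \<in> V. incseq (\<lambda>j. Poly_Mapping.lookup (s (r j)) v)"
    using incseq_subseq_componentwise[OF assms(1), of "\<lambda>j. Poly_Mapping.lookup (s j)"] by blast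
  have "Poly_Mapping.lookup (s (r 0)) v \<le> Poly_Mapping.lookup (s (r 1)) v" for v
  proof (cases "v \<in> V")
    case True
    with r(2) show ?thesis by (auto simp: incseq_def)
  next
    case False
    with assms(2) have "v \<notin> Poly_Mapping.keys (s (r 0))" by blast
    then show ?thesis by (simp add: Poly_Mapping.in_keys_iff)
  qed
  then have "s (r 1) = s (r 0) + (s (r 1) - s (r 0))"
    by (rule poly_mapping_add_diff)
  moreover have "r 0 < r 1" using r(1) by (simp add: strict_mono_def)
  ultimately show ?thesis using that by blast
qed

text \<open>Finiteness of \<open>V\<close> matters: the vectors
  \<open>Poly_Mapping.single i 1\<close> descend forever as \<open>i\<close> grows. Over finite
  \<open>V\<close>, a descending chain would contain some \<open>s i\<close> dividing a later
  \<open>s j\<close>, which forces \<open>s i \<le> s j\<close>.\<close>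

lemma wf_lex_exponents:
  assumes "finite V"
  shows "wf {(u, v :: nat \<Rightarrow>\<^sub>0 nat). Poly_Mapping.keys u \<subseteq> V \<and> Poly_Mapping.keys v \<subseteq> V \<and> u < v}"
  unfolding wf_iff_no_infinite_down_chain
proof
  assume "\<exists>s. \<forall>i. (s (Suc i), s i) \<in> {(u, v :: nat \<Rightarrow>\<^sub>0 nat).
    Poly_Mapping.keys u \<subseteq> V \<and> Poly_Mapping.keys v \<subseteq> V \<and> u < v}"
  then obtain s :: "nat \<Rightarrow> nat \<Rightarrow>\<^sub>0 nat"
    where keys: "\<And>i. Poly_Mapping.keys (s i) \<subseteq> V" and desc: "\<And>i. s (Suc i) < s i"
    by auto
  obtain i j d where ij: "i < j" "s j = s i + d"
    using poly_mapping_good_sequence[OF assms, of s] keys by blast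
  have "s (Suc (i + k)) < s i" for k
    by (induction k) (use desc in \<open>auto intro: less_trans\<close>)
  with ij(1) have "s j < s i"
    by (auto dest: less_imp_Suc_add)
  moreover have "s i \<le> s j"
    using add_left_mono[OF zero_le_poly_mapping[of d], of "s i"] ij(2) by simp
  ultimately show False by simp
qed

text \<open>\<open>F\<close> collects the members minimal under divisibility; infinitely many would
  include a comparable pair. A divisor is never lexicographically larger, so the lexicographically
  least divisor of \<open>m\<close> in \<open>S\<close> lies in \<open>F\<close>.\<close>

lemma dickson:
  fixes S :: "(nat \<Rightarrow>\<^sub>0 nat) set"
  assumes "finite V" "\<And>m. m \<in> S \<Longrightarrow> Poly_Mapping.keys m \<subseteq> V"
  obtains F where "finite F" "F \<subseteq> S" "\<And>m. m \<in> S \<Longrightarrow> \<exists>t \<in> F. \<exists>d. m = t + d"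
proof
  define F where "F = {m \<in> S. \<forall>t \<in> S. \<forall>d. m = t + d \<longrightarrow> t = m}"
  show "F \<subseteq> S" by (auto simp: F_def)
  show "finite F"
  proof (rule ccontr)
    assume "infinite F"
    then obtain s :: "nat \<Rightarrow> nat \<Rightarrow>\<^sub>0 nat" where s: "inj s" "range s \<subseteq> F"
      using infinite_countable_subset by blast
    obtain i j d where ij: "i < j" "s j = s i + d"
      using poly_mapping_good_sequence[OF assms(1), of s] s(2) assms(2) \<open>F \<subseteq> S\<close>
      by (metis range_subsetD subsetD)
    moreover have "s i \<in> S" "s j \<in> F" using s(2) \<open>F \<subseteq> S\<close> by auto
    ultimately have "s i = s j" unfolding F_def by blast
    with s(1) ij(1) show False by (auto dest: injD)
  qed
  fix m assume "m \<in> S"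
  then have "m \<in> {t \<in> S. \<exists>d. m = t + d}" by (auto intro: exI[of _ 0])
  then obtain t where t: "t \<in> S" "\<exists>d. m = t + d"
    and least: "\<And>u. Poly_Mapping.keys u \<subseteq> V \<Longrightarrow> Poly_Mapping.keys t \<subseteq> V \<Longrightarrow> u < t \<Longrightarrow>
      u \<notin> {t \<in> S. \<exists>d. m = t + d}"
    using wfE_min[OF wf_lex_exponents[OF assms(1)]] by (smt (verit) mem_Collect_eq case_prodI)
  have "t \<in> F"
    unfolding F_def
  proof (intro CollectI conjI ballI allI impI)
    show "t \<in> S" by fact
    fix u e assume u: "u \<in> S" "t = u + e"
    then have "u \<le> t"
      using add_left_mono[OF zero_le_poly_mapping[of e], of u] by simp
    moreover have "\<exists>d. m = u + d"
      using t(2) u(2) by (auto simp: add.assoc)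
    ultimately show "u = t"
      using least[of u] u(1) t(1) assms(2) by (auto simp: order.order_iff_strict)
  qed
  with t(2) show "\<exists>t \<in> F. \<exists>d. m = t + d" by blast
qed

subsection \<open>Leading terms with coefficients in \<open>k[x\<^sub>1]\<close>\<close>

text \<open>\<open>rest u\<close> is the exponent vector of the part of a monomial that does not involve \<open>x\<^sub>1\<close>.\<close>

abbreviation rest :: "(nat \<Rightarrow>\<^sub>0 nat) \<Rightarrow> nat \<Rightarrow>\<^sub>0 nat" where
  "rest u \<equiv> Poly_Mapping.update 1 0 u"

lemma rest_idem: "1 \<notin> Poly_Mapping.keys m \<Longrightarrow> rest m = m"
  by (rule poly_mapping_eqI) (auto simp: lookup_update Poly_Mapping.in_keys_iff)

lemma rest_split: "u = Poly_Mapping.single 1 (Poly_Mapping.lookup u 1) + rest u"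
  by (rule poly_mapping_eqI) (auto simp: lookup_update lookup_add lookup_single when_def)

lemma rest_zero_iff: "rest u = 0 \<longleftrightarrow> Poly_Mapping.keys u \<subseteq> {1}"
proof -
  have "rest u = 0 \<longleftrightarrow> Poly_Mapping.keys (rest u) = {}" by simp
  then show ?thesis by (auto simp: keys_update)
qed

lemma mpolys_single_var: "f \<in> mpolys {1} \<longleftrightarrow> (\<forall>u \<in> Poly_Mapping.keys f. rest u = 0)"
  by (simp add: mpolys_def rest_zero_iff)

lemma mpolys_mono: "V \<subseteq> W \<Longrightarrow> mpolys V \<subseteq> mpolys W"
  by (auto simp: mpolys_def)

lemma mpolys_diff: "f \<in> mpolys V \<Longrightarrow> g \<in> mpolys V \<Longrightarrow> f - g \<in> mpolys V"
  for f g :: "'k::comm_ring_1 mpoly"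
  using mpolys_add[OF _ mpolys_uminus, of f V g] by simp

lemma mpolys_power: "f \<in> mpolys V \<Longrightarrow> f ^ N \<in> mpolys V"
  for f :: "'k::comm_ring_1 mpoly"
  by (induction N) (auto simp: mpolys_one mpolys_mult)

lemma mpolys_prod: "(\<And>x. x \<in> A \<Longrightarrow> F x \<in> mpolys V) \<Longrightarrow> prod F A \<in> mpolys V"
  for F :: "'a \<Rightarrow> 'k::comm_ring_1 mpoly"
  by (induction A rule: infinite_finite_induct) (auto simp: mpolys_one mpolys_mult)

lemma mpolys_single: "Poly_Mapping.keys m \<subseteq> V \<Longrightarrow> Poly_Mapping.single m c \<in> mpolys V"
  by (auto simp: mpolys_def)

lemma rest_keys_mult_coeff:
  fixes p f :: "'k::comm_ring_1 mpoly"
  assumes "p \<in> mpolys {1}" "u \<in> Poly_Mapping.keys (p * f)"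
  shows "\<exists>v \<in> Poly_Mapping.keys f. rest u = rest v"
proof -
  obtain a v where "u = a + v" "a \<in> Poly_Mapping.keys p" "v \<in> Poly_Mapping.keys f"
    using assms(2) Poly_Mapping.keys_mult[of p f] by blast
  moreover from this assms(1) have "rest a = 0" by (simp add: mpolys_single_var)
  ultimately show ?thesis by (auto simp: update_exponent_add)
qed

text \<open>Over k[x1], \<open>p\<close> is the leading coefficient and \<open>m\<close> the leading
  monomial of \<open>f\<close>. Requiring \<open>m\<close> to occur in \<open>f\<close> forces
  \<open>p\<close> to be nonzero.\<close>

definition has_lead :: "'k::comm_ring_1 mpoly \<Rightarrow> 'k mpoly \<Rightarrow> (nat \<Rightarrow>\<^sub>0 nat) \<Rightarrow> bool" where
  "has_lead f p m \<longleftrightarrow> p \<in> mpolys {1} \<and> m \<in> rest ` Poly_Mapping.keys f \<and>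
     (\<forall>u \<in> Poly_Mapping.keys (f - p * Poly_Mapping.single m 1). rest u < m)"

lemma has_lead_nonzero: "has_lead f p m \<Longrightarrow> p \<noteq> 0"
  unfolding has_lead_def by fastforce

lemma has_lead_keys: "has_lead f p m \<Longrightarrow> (1::nat) \<notin> Poly_Mapping.keys m"
  by (auto simp: has_lead_def keys_update)

lemma has_lead_exists:
  fixes f :: "'k::comm_ring_1 mpoly"
  assumes "f \<noteq> 0"
  obtains p m where "has_lead f p m"
proof -
  let ?K = "Poly_Mapping.keys f"
  define m where "m = Max (rest ` ?K)"
  \<comment> \<open>The coefficient of \<open>m\<close> over k[x1]: the x1-parts of all terms of
    \<open>f\<close> lying over \<open>m\<close>.\<close>
  define p where "p = (\<Sum>u \<in> {u \<in> ?K. rest u = m}.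
    Poly_Mapping.single (Poly_Mapping.single (1::nat) (Poly_Mapping.lookup u 1)) (Poly_Mapping.lookup f u))"
  have "m \<in> rest ` ?K"
    using assms unfolding m_def by (intro Max_in) auto
  moreover have "p \<in> mpolys {1}"
    unfolding p_def by (intro mpolys_sum mpolys_single) auto
  moreover have "rest u < m" if u: "u \<in> Poly_Mapping.keys (f - p * Poly_Mapping.single m 1)" for u
  proof -
    have "p * Poly_Mapping.single m 1 =
        (\<Sum>u \<in> {u \<in> ?K. rest u = m}. Poly_Mapping.single u (Poly_Mapping.lookup f u))"
      unfolding p_def sum_distrib_right mult_single
      by (intro sum.cong) (auto simp flip: rest_split)
    then have "Poly_Mapping.lookup (p * Poly_Mapping.single m 1) v =
        (if v \<in> ?K \<and> rest v = m then Poly_Mapping.lookup f v else 0)" for v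
      by (simp add: lookup_sum lookup_single when_def sum.delta')
    with u have "u \<in> ?K" "rest u \<noteq> m"
      by (auto simp: Poly_Mapping.in_keys_iff lookup_minus split: if_splits)
    then show ?thesis
      unfolding m_def by (intro order.not_eq_order_implies_strict Max_ge) auto
  qed
  ultimately have "has_lead f p m" by (simp add: has_lead_def)
  then show ?thesis by (rule that)
qed

subsection \<open>Evaluation\<close>

lemma single_sum_distrib:
  "Poly_Mapping.single k (sum F A) = (\<Sum>x \<in> A. Poly_Mapping.single k (F x))"
  by (induction A rule: infinite_finite_induct) (auto simp: Poly_Mapping.single_add)

text \<open>Translates to univariate polynomials, where a nonzero polynomial has finitely many
  roots.\<close>

lemma ev_coeff:
  assumes "p \<in> mpolys {1}"
  shows "ev a p = Poly_Mapping.single 0 (poly (\<Sum>u \<in> Poly_Mapping.keys p.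
    monom (Poly_Mapping.lookup p u) (Poly_Mapping.lookup u 1)) a)"
  using assms
  by (simp add: ev_def mpolys_single_var poly_sum poly_monom single_sum_distrib)

lemma ev_coeff_nonzero:
  fixes p :: "'k::field mpoly"
  assumes "infinite (UNIV :: 'k set)" "p \<in> mpolys {1}" "p \<noteq> 0"
  obtains a where "ev a p \<noteq> 0"
proof -
  define q where "q = (\<Sum>u \<in> Poly_Mapping.keys p.
    monom (Poly_Mapping.lookup p u) (Poly_Mapping.lookup u 1))"
  \<comment> \<open>A monomial of \<open>p\<close> is determined by its x1-exponent, so no two terms
    merge in \<open>q\<close> and its coefficients are those of \<open>p\<close>.\<close>
  have inj: "u = v" if "u \<in> Poly_Mapping.keys p" "v \<in> Poly_Mapping.keys p"
      "Poly_Mapping.lookup u 1 = Poly_Mapping.lookup v 1" for u v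
    using that assms(2) by (metis rest_split mpolys_single_var)
  obtain u where u: "u \<in> Poly_Mapping.keys p" using assms(3) by fastforce
  have "coeff q (Poly_Mapping.lookup u 1) =
      (\<Sum>v \<in> Poly_Mapping.keys p. if v = u then Poly_Mapping.lookup p v else 0)"
    unfolding q_def coeff_sum using inj u by (intro sum.cong) auto
  with u have "q \<noteq> 0"
    by (auto simp: Poly_Mapping.in_keys_iff)
  then obtain a where "poly q a \<noteq> 0"
    using poly_roots_finite[of q] assms(1) by (auto dest: ex_new_if_finite)
  then have "ev a p \<noteq> 0"
    using ev_coeff[OF assms(2), of a]
    by (simp add: q_def flip: Poly_Mapping.keys_eq_empty)
  then show ?thesis by (rule that)
qed

text \<open>Term by term, this is the divisibility of \<open>x ^ e - a ^ e\<close> by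
  \<open>x - a\<close>; the cofactor \<open>s\<close> is the usual geometric sum.\<close>

lemma ev_decomposition:
  fixes f :: "'k::comm_ring_1 mpoly"
  assumes "f \<in> mpolys V" "1 \<in> V"
  obtains g where "g \<in> mpolys V"
    "f = ev a f + (Poly_Mapping.single (Poly_Mapping.single 1 1) 1 - Poly_Mapping.single 0 a) * g"
proof -
  let ?x = "Poly_Mapping.single (Poly_Mapping.single 1 1) 1 :: 'k mpoly"
  let ?a = "Poly_Mapping.single 0 a :: 'k mpoly"
  have pow: "Poly_Mapping.single (Poly_Mapping.single (1::nat) e) 1 = ?x ^ e" for e :: nat
  proof (induction e)
    case (Suc e)
    then show ?case
      by (simp add: mult_single plus_1_eq_Suc flip: Suc.IH single_add)
  qed simp
  have pow': "Poly_Mapping.single 0 (a ^ e) = ?a ^ e" for e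
  proof (induction e)
    case (Suc e)
    then show ?case
      by (simp add: mult_single flip: Suc.IH)
  qed simp
  have decomp: "\<exists>g \<in> mpolys V. Poly_Mapping.single u c = ev a (Poly_Mapping.single u c) + (?x - ?a) * g"
    if u: "Poly_Mapping.keys u \<subseteq> V" for u c
  proof -
    let ?e = "Poly_Mapping.lookup u 1"
    let ?y = "Poly_Mapping.single (rest u) c"
    define s where "s = (\<Sum>i<?e. ?a ^ (?e - Suc i) * ?x ^ i)"
    have "s \<in> mpolys V"
      unfolding s_def using assms(2)
      by (intro mpolys_sum mpolys_mult mpolys_power mpolys_single) auto
    moreover have "?y \<in> mpolys V"
      using u by (intro mpolys_single) (auto simp: keys_update)
    moreover have "Poly_Mapping.single u c = ?x ^ ?e * ?y"
      by (simp add: mult_single flip: pow rest_split)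
    moreover have "ev a (Poly_Mapping.single u c) = ?a ^ ?e * ?y"
      by (simp add: ev_single mult_single mult.commute flip: pow')
    moreover have "?x ^ ?e - ?a ^ ?e = (?x - ?a) * s"
      unfolding s_def by (rule power_diff_sumr2)
    then have "?x ^ ?e = ?a ^ ?e + (?x - ?a) * s"
      by (simp only: diff_eq_eq add.commute)
    then have "?x ^ ?e * ?y = ?a ^ ?e * ?y + (?x - ?a) * (s * ?y)"
      by (simp only: distrib_right mult.assoc)
    ultimately show ?thesis by (metis mpolys_mult)
  qed
  have "\<forall>u \<in> Poly_Mapping.keys f. \<exists>g. g \<in> mpolys V \<and>
      Poly_Mapping.single u (Poly_Mapping.lookup f u) =
        ev a (Poly_Mapping.single u (Poly_Mapping.lookup f u)) + (?x - ?a) * g"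
    using decomp assms(1) by (auto simp: mpolys_def)
  then obtain G where G: "\<And>u. u \<in> Poly_Mapping.keys f \<Longrightarrow> G u \<in> mpolys V"
    "\<And>u. u \<in> Poly_Mapping.keys f \<Longrightarrow> Poly_Mapping.single u (Poly_Mapping.lookup f u) =
        ev a (Poly_Mapping.single u (Poly_Mapping.lookup f u)) + (?x - ?a) * G u"
    by metis
  have "f = (\<Sum>u \<in> Poly_Mapping.keys f. ev a (Poly_Mapping.single u (Poly_Mapping.lookup f u))
      + (?x - ?a) * G u)"
    by (subst mpoly_eq_sum_single) (intro sum.cong refl G(2))
  also have "\<dots> = ev a f + (?x - ?a) * sum G (Poly_Mapping.keys f)"
    by (simp add: sum.distrib sum_distrib_left flip: ev_sum mpoly_eq_sum_single)
  finally show ?thesis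
    using that[of "sum G (Poly_Mapping.keys f)"] G(1) by (auto intro: mpolys_sum)
qed

subsection \<open>Division with remainder\<close>

locale mpoly_ideal =
  fixes n :: nat and I :: "'k::field mpoly set"
  assumes ideal_I: "ideal I (mpoly_ring {1..n})" and n_pos: "n \<ge> 1"
begin

lemma I_subset: "I \<subseteq> mpolys {1..n}"
  using additive_subgroup.a_subset[OF ideal.axioms(1)[OF ideal_I]] by (simp add: mpoly_ring_def)

lemma I_zero: "0 \<in> I"
  using additive_subgroup.zero_closed[OF ideal.axioms(1)[OF ideal_I]] by (simp add: mpoly_ring_def)

lemma I_add: "f \<in> I \<Longrightarrow> g \<in> I \<Longrightarrow> f + g \<in> I"
  using additive_subgroup.a_closed[OF ideal.axioms(1)[OF ideal_I], of f g]
  by (simp add: mpoly_ring_def)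

lemma I_mult: "f \<in> I \<Longrightarrow> q \<in> mpolys {1..n} \<Longrightarrow> q * f \<in> I"
  using ideal.I_l_closed[OF ideal_I, of f q] by (simp add: mpoly_ring_def)

lemma I_diff: "f \<in> I \<Longrightarrow> g \<in> I \<Longrightarrow> f - g \<in> I"
  using I_add[of f "- 1 * g"] I_mult[of g "- 1"] by (simp add: mpolys_uminus mpolys_one)

lemma coeff_subset: "p \<in> mpolys {1} \<Longrightarrow> p \<in> mpolys {1..n}"
  using mpolys_mono[of "{1}" "{1..n}"] n_pos by auto

definition leads :: "(nat \<Rightarrow>\<^sub>0 nat) set" where
  "leads = {m. \<exists>f \<in> I. \<exists>p. has_lead f p m}"

text \<open>Since \<open>rest\<close> ignores x1, these polynomials form a free k[x1]-module on the
  monomials in the other variables outside \<open>leads\<close>.\<close>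

definition standard :: "'k mpoly \<Rightarrow> bool" where
  "standard r \<longleftrightarrow> r \<in> mpolys {1..n} \<and> (\<forall>u \<in> Poly_Mapping.keys r. rest u \<notin> leads)"

lemma has_lead_keys_subset:
  "has_lead f p m \<Longrightarrow> f \<in> mpolys {1..n} \<Longrightarrow> Poly_Mapping.keys m \<subseteq> {1..n}"
  by (fastforce simp: has_lead_def mpolys_def keys_update)

lemma leads_keys: "m \<in> leads \<Longrightarrow> Poly_Mapping.keys m \<subseteq> {1..n}"
  using has_lead_keys_subset I_subset by (auto simp: leads_def)

lemma standard_add: "standard r \<Longrightarrow> standard s \<Longrightarrow> standard (r + s)"
  using Poly_Mapping.keys_add[of r s] by (auto simp: standard_def mpolys_add)

lemma standard_mult: "p \<in> mpolys {1} \<Longrightarrow> standard r \<Longrightarrow> standard (p * r)"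
  unfolding standard_def
  by (metis rest_keys_mult_coeff mpolys_mult coeff_subset)

lemma standard_ideal_zero:
  assumes "standard r" "r \<in> I"
  shows "r = 0"
proof (rule ccontr)
  assume "r \<noteq> 0"
  then obtain p m where lead: "has_lead r p m" using has_lead_exists by blast
  then have "m \<in> rest ` Poly_Mapping.keys r" "m \<in> leads"
    using assms(2) by (auto simp: has_lead_def leads_def)
  with assms(1) show False by (auto simp: standard_def)
qed

text \<open>Nothing lies below the monomial \<open>0\<close>, so an \<open>f\<close> with this
  leading monomial equals its leading coefficient and is a nonzero element of k[x1]. The payoff is
  that \<open>1\<close> is standard.\<close>

lemma zero_notin_leads:
  assumes "I \<inter> mpolys {1} = {0}"
  shows "0 \<notin> leads"
proof
  assume "0 \<in> leads"
  then obtain f p where f: "f \<in> I" and lead: "has_lead f p 0" by (auto simp: leads_def)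
  then have "Poly_Mapping.keys (f - p * Poly_Mapping.single 0 1) = {}"
    unfolding has_lead_def using zero_le_poly_mapping leD by blast
  then have "f = p" by (simp add: Poly_Mapping.single_one)
  moreover have "p \<in> mpolys {1}" "p \<noteq> 0"
    using lead has_lead_nonzero[OF lead] by (auto simp: has_lead_def)
  ultimately show False using f assms by blast
qed

text \<open>Division with remainder after inverting \<open>h\<close>, with the power
  \<open>h ^ N\<close> clearing the denominators.\<close>

definition reducible_by :: "'k mpoly \<Rightarrow> 'k mpoly \<Rightarrow> bool" where
  "reducible_by h g \<longleftrightarrow> (\<exists>N r. standard r \<and> h ^ N * g - r \<in> I)"

lemma reducible_by_zero: "reducible_by h 0"
  unfolding reducible_by_def
  by (intro exI[of _ 0]) (auto simp: standard_def mpolys_zero I_zero)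

text \<open>The multiplier \<open>w\<close> is chosen so that \<open>w * f\<close> has the leading
  part \<open>(p' * q) * p\<close> at \<open>t + d\<close>. This is \<open>h * p\<close>, the
  leading part of \<open>h * g\<close>, so the two cancel and only the tails remain.\<close>

lemma reduction_step:
  assumes h: "h \<in> mpolys {1}" "h = p' * q" "q \<in> mpolys {1}"
    and f: "f \<in> I" "has_lead f p' t"
    and g: "g \<in> mpolys {1..n}" "has_lead g p (t + d)"
  obtains g' where "g' \<in> mpolys {1..n}" "h * g - g' \<in> I"
    "\<And>u. u \<in> Poly_Mapping.keys g' \<Longrightarrow> rest u < t + d"
proof -
  let ?X = "\<lambda>m. Poly_Mapping.single m 1 :: 'k mpoly"
  define w where "w = (q * p) * ?X d"
  have d: "Poly_Mapping.keys d \<subseteq> Poly_Mapping.keys (t + d)"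
    by (auto simp: Poly_Mapping.in_keys_iff lookup_add)
  have p: "p \<in> mpolys {1}" using g(2) by (simp add: has_lead_def)
  have "w \<in> mpolys {1..n}"
    unfolding w_def using d has_lead_keys_subset[OF g(2,1)] h(3) p
    by (intro mpolys_mult coeff_subset mpolys_single) auto
  moreover have "h * g \<in> mpolys {1..n}"
    using coeff_subset[OF h(1)] g(1) by (rule mpolys_mult)
  ultimately have "w * f \<in> I" "h * g - w * f \<in> mpolys {1..n}"
    using f(1) I_subset by (auto intro!: I_mult mpolys_diff mpolys_mult)
  moreover have "rest u < t + d" if "u \<in> Poly_Mapping.keys (h * g - w * f)" for u
  proof -
    have "h * g - w * f = h * (g - p * ?X (t + d)) - w * (f - p' * ?X t)"
    proof -
      have "?X (t + d) = ?X t * ?X d" by (simp add: mult_single)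
      then show ?thesis by (simp add: h(2) w_def algebra_simps)
    qed
    with that consider "u \<in> Poly_Mapping.keys (h * (g - p * ?X (t + d)))"
      | "u \<in> Poly_Mapping.keys ((q * p) * (?X d * (f - p' * ?X t)))"
      using keys_diff[of "h * (g - p * ?X (t + d))" "w * (f - p' * ?X t)"]
      by (auto simp: w_def mult.assoc)
    then show ?thesis
    proof cases
      case 1
      then show ?thesis
        using rest_keys_mult_coeff[OF h(1)] g(2) by (fastforce simp: has_lead_def)
    next
      case 2
      then obtain v where v: "v \<in> Poly_Mapping.keys (?X d * (f - p' * ?X t))" "rest u = rest v"
        using rest_keys_mult_coeff[OF mpolys_mult[OF h(3) p]] by blast
      then obtain v' where v': "v = d + v'" "v' \<in> Poly_Mapping.keys (f - p' * ?X t)"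
        using Poly_Mapping.keys_mult[of "?X d" "f - p' * ?X t"] by auto
      \<comment> \<open>\<open>t + d\<close> does not involve x1, hence neither does
        \<open>d\<close>; multiplying by it shifts each \<open>rest\<close> by exactly
        \<open>d\<close>, and the order is translation invariant.\<close>
      have "rest d = d"
        using d has_lead_keys[OF g(2)] by (intro rest_idem) auto
      then have "rest u = d + rest v'"
        using v(2) v'(1) by (simp add: update_exponent_add)
      also have "\<dots> < d + t"
        using v'(2) f(2) by (intro add_strict_left_mono) (auto simp: has_lead_def)
      finally show ?thesis by (simp add: add.commute)
    qed
  qed
  ultimately show ?thesis
    using that[of "h * g - w * f"] by simp
qed

text \<open>Well-founded induction on the leading monomial \<open>m\<close>. If \<open>m\<close> is
  in \<open>leads\<close>, one reduction step lowers it at the cost of a factor \<open>h\<close>;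
  otherwise the leading term is already standard and only the tail is reduced.\<close>

lemma has_lead_reducible:
  assumes h: "h \<in> mpolys {1}"
    and F: "\<And>m. m \<in> leads \<Longrightarrow> \<exists>f \<in> I. \<exists>p t d q. has_lead f p t \<and> m = t + d \<and> h = p * q \<and> q \<in> mpolys {1}"
    and "g \<in> mpolys {1..n}" "has_lead g p m"
  shows "reducible_by h g"
  using assms(3,4)
proof (induction m arbitrary: g p rule: wf_induct_rule[OF wf_lex_exponents[of "{1..n}"]])
  case 1
  show ?case by simp
next
  case (2 m)
  have smaller: "reducible_by h g'"
    if g': "g' \<in> mpolys {1..n}" "\<And>u. u \<in> Poly_Mapping.keys g' \<Longrightarrow> rest u < m" for g'
  proof (cases "g' = 0")
    case True
    then show ?thesis by (simp add: reducible_by_zero)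
  next
    case False
    then obtain p' m' where lead: "has_lead g' p' m'" using has_lead_exists by blast
    then have "m' < m" using g'(2) by (auto simp: has_lead_def)
    then show ?thesis
      using 2(1)[of m' g' p'] 2(2,3) lead g'(1) has_lead_keys_subset by blast
  qed
  show ?case
  proof (cases "m \<in> leads")
    case True
    then obtain f p' t d q where "f \<in> I" "has_lead f p' t" "m = t + d" "h = p' * q" "q \<in> mpolys {1}"
      using F by blast
    then obtain g' where g': "g' \<in> mpolys {1..n}" "h * g - g' \<in> I"
        "\<And>u. u \<in> Poly_Mapping.keys g' \<Longrightarrow> rest u < m"
      using reduction_step[OF h] 2(2,3) by metis
    then obtain N r where r: "standard r" "h ^ N * g' - r \<in> I"
      using smaller unfolding reducible_by_def by blast
    have "h ^ N * (h * g - g') + (h ^ N * g' - r) \<in> I"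
      using g'(2) r(2) h by (intro I_add I_mult coeff_subset mpolys_power)
    then have "h ^ Suc N * g - r \<in> I" by (simp add: algebra_simps)
    with r(1) show ?thesis unfolding reducible_by_def by blast
  next
    case False
    let ?l = "p * Poly_Mapping.single m 1"
    have p: "p \<in> mpolys {1}" and keys: "Poly_Mapping.keys m \<subseteq> {1..n}"
      using 2(2,3) has_lead_keys_subset by (auto simp: has_lead_def)
    then have l: "?l \<in> mpolys {1..n}"
      by (intro mpolys_mult coeff_subset mpolys_single)
    have "standard (Poly_Mapping.single m 1)"
      using False keys rest_idem[OF has_lead_keys[OF 2(3)]]
      by (auto simp: standard_def intro: mpolys_single)
    then have "standard ?l" using p by (intro standard_mult)
    moreover obtain N r where r: "standard r" "h ^ N * (g - ?l) - r \<in> I"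
      using smaller[of "g - ?l"] 2(2,3) l unfolding reducible_by_def
      by (auto simp: has_lead_def mpolys_diff)
    ultimately have "standard (h ^ N * ?l + r)"
      using h by (intro standard_add standard_mult[OF mpolys_power])
    moreover have "h ^ N * g - (h ^ N * ?l + r) \<in> I"
      using r(2) by (simp add: algebra_simps)
    ultimately show ?thesis unfolding reducible_by_def by blast
  qed
qed

text \<open>One \<open>h\<close> serves all \<open>g\<close>: by Dickson's lemma finitely many
  leading coefficients suffice, and their product is divisible by each of them and nonzero.\<close>

lemma generic_reduction:
  obtains h where "h \<in> mpolys {1}" "h \<noteq> 0" "\<And>g. g \<in> mpolys {1..n} \<Longrightarrow> reducible_by h g"
proof -
  obtain T where T: "finite T" "T \<subseteq> leads" "\<And>m. m \<in> leads \<Longrightarrow> \<exists>t \<in> T. \<exists>d. m = t + d"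
    using dickson[of "{1..n}" leads] leads_keys by auto
  have "\<forall>t \<in> T. \<exists>f p. f \<in> I \<and> has_lead f p t"
    using T(2) unfolding leads_def by blast
  then obtain f p where fp: "\<And>t. t \<in> T \<Longrightarrow> f t \<in> I \<and> has_lead (f t) (p t) t"
    by metis
  define h where "h = prod p T"
  have p: "p t \<in> mpolys {1}" "p t \<noteq> 0" if "t \<in> T" for t
    using fp[OF that] has_lead_nonzero by (auto simp: has_lead_def)
  have h: "h \<in> mpolys {1}" "h \<noteq> 0"
    unfolding h_def using p T(1) by (auto intro: mpolys_prod)
  have F: "\<exists>f \<in> I. \<exists>p t d q. has_lead f p t \<and> m = t + d \<and> h = p * q \<and> q \<in> mpolys {1}"
    if "m \<in> leads" for m
  proof -
    obtain t d where t: "t \<in> T" "m = t + d" using T(3) \<open>m \<in> leads\<close> by blast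
    have "h = p t * prod p (T - {t})" "prod p (T - {t}) \<in> mpolys {1}"
      unfolding h_def using T(1) t(1) p by (auto simp: prod.remove intro: mpolys_prod)
    with t fp show ?thesis by blast
  qed
  have "reducible_by h g" if "g \<in> mpolys {1..n}" for g
    using has_lead_reducible[OF h(1) F that] has_lead_exists[of g] reducible_by_zero by metis
  with h show ?thesis by (rule that)
qed

end

section \<open>Specialisation at a point where \<open>h\<close> does not vanish\<close>

theorem corollary1:
  fixes n :: nat and I :: "'k::field mpoly set"
  assumes "infinite (UNIV :: 'k set)"
    and "n \<ge> 1"
    and "ideal I (mpoly_ring {1..n})"
    and "I \<inter> mpolys {1} = {0}"
  shows "\<exists>a :: 'k. ev a ` I \<noteq> mpolys {2..n}"
proof -
  interpret mpoly_ideal n I using assms(3,2) by (rule mpoly_ideal.intro)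
  obtain h where h: "h \<in> mpolys {1}" "h \<noteq> 0" "\<And>g. g \<in> mpolys {1..n} \<Longrightarrow> reducible_by h g"
    using generic_reduction by blast
  \<comment> \<open>\<open>h\<close> is fixed before \<open>a\<close>; only \<open>N\<close> and
    \<open>r\<close> below depend on \<open>a\<close>.\<close>
  obtain a where a: "ev a h \<noteq> 0"
    using ev_coeff_nonzero[OF assms(1) h(1,2)] by blast
  have "1 \<notin> ev a ` I"
  proof
    assume "1 \<in> ev a ` I"
    then obtain f where f: "f \<in> I" "ev a f = 1" by auto
    define x where
      "x = (Poly_Mapping.single (Poly_Mapping.single 1 1) 1 - Poly_Mapping.single 0 a :: 'k mpoly)"
    obtain g where g: "g \<in> mpolys {1..n}" "f = 1 + x * g"
      using ev_decomposition[of f "{1..n}" a] f I_subset n_pos unfolding x_def by auto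
    obtain N r where r: "standard r" "h ^ N * g - r \<in> I"
      using h(3)[OF g(1)] unfolding reducible_by_def by blast
    have x: "x \<in> mpolys {1}"
      unfolding x_def by (intro mpolys_diff mpolys_single) auto
    \<comment> \<open>The hypothesis on the intersection with k[x1] enters here.\<close>
    have "standard 1"
      using zero_notin_leads[OF assms(4)] by (auto simp: standard_def mpolys_one update_zero)
    then have "standard (h ^ N * 1 + x * r)"
      using h(1) x r(1) by (intro standard_add standard_mult mpolys_power)
    \<comment> \<open>As \<open>f = 1 + x * g\<close>, this replaces \<open>h ^ N * g\<close> by its
      remainder \<open>r\<close> modulo \<open>I\<close>.\<close>
    moreover have "h ^ N * f - x * (h ^ N * g - r) \<in> I"
      by (intro I_diff I_mult[OF f(1)] I_mult[OF r(2)] coeff_subset mpolys_power h(1) x)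
    then have "h ^ N * 1 + x * r \<in> I"
      by (simp add: g(2) algebra_simps)
    ultimately have "h ^ N * 1 + x * r = 0"
      by (rule standard_ideal_zero)
    \<comment> \<open>Evaluation at \<open>a\<close> kills the summand \<open>x * r\<close>, leaving
      only the power of \<open>ev a h\<close>.\<close>
    moreover have "ev a x = 0"
      using ev_add[of a x "Poly_Mapping.single 0 a"] ev_var[of a 1] by (simp add: x_def ev_const)
    moreover have "ev a (h ^ N) = ev a h ^ N"
      by (induction N) (simp_all add: ev_mult ev_const flip: Poly_Mapping.single_one)
    ultimately have "ev a h ^ N = 0"
      by (metis add.right_neutral ev_add ev_mult ev_zero mult.right_neutral mult_zero_left)
    with a show False by simp
  qed
  then show ?thesis using mpolys_one by blast
qed

end
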